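(* Let $n>1$ be an integer and $p=c/(2n)$ with $c\in\{1,\dots,2n-1\}$. Then there are exactly $2^{\aleph_0}$ pairwise non-isomorphic $p$-biased functions on $\mathbb{Z}^n$.
   Context: $\mathbb{Z}^n$ is the graph with edges $\{x,x+e_i\}$, $x\in\mathbb{Z}^n$, $i\in\{1,\dots,n\}$; $\Gamma(x)=\{x\pm e_i\}$. A function $f:\mathbb{Z}^n\to\{0,1\}$ (identified with its support $X$) is $p$-biased if $|\Gamma(x)\cap X|=2pn$ for every $x\in\mathbb{Z}^n$. Two such functions $f,g$ are isomorphic if there is a graph automorphism $\phi$ of $\mathbb{Z}^n$ with $f=g\circ\phi$ (equivalently $\phi$ maps the support of $f$ onto the support of $g$). *)

theory Defs
  imports "HOL-Analysis.Finite_Cartesian_Product" "HOL-Library.Equipollence"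
begin

definition grid_edges :: "(int ^ 'n) set set" where
  "grid_edges = {{x, x + axis i 1} | x i. True}"

definition grid_nbhd :: "int ^ 'n \<Rightarrow> (int ^ 'n) set" where
  "grid_nbhd x = (\<Union>i. {x + axis i 1, x - axis i 1})"

lemma grid_nbhd_iff_edge: "y \<in> grid_nbhd x \<longleftrightarrow> {x, y} \<in> grid_edges"
proof
  assume "y \<in> grid_nbhd x"
  then obtain i where "y = x + axis i 1 \<or> y = x - axis i 1"
    by (auto simp: grid_nbhd_def)
  then show "{x, y} \<in> grid_edges"
  proof
    assume "y = x + axis i 1"
    then show ?thesis by (auto simp: grid_edges_def)
  next
    assume "y = x - axis i 1"
    then have "{x, y} = {y, y + axis i 1}" by auto
    then show ?thesis unfolding grid_edges_def by blast
  qed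
next
  assume "{x, y} \<in> grid_edges"
  then show "y \<in> grid_nbhd x"
    by (auto simp: grid_edges_def grid_nbhd_def doubleton_eq_iff)
qed

definition grid_automorphism :: "(int ^ 'n \<Rightarrow> int ^ 'n) \<Rightarrow> bool" where
  "grid_automorphism \<phi> \<longleftrightarrow>
     bij \<phi> \<and> (\<forall>x y. {x, y} \<in> grid_edges \<longleftrightarrow> {\<phi> x, \<phi> y} \<in> grid_edges)"

definition biased :: "real \<Rightarrow> (int ^ 'n \<Rightarrow> nat) \<Rightarrow> bool" where
  "biased p f \<longleftrightarrow> range f \<subseteq> {0, 1} \<and>
     (\<forall>x. real (card (grid_nbhd x \<inter> {y. f y \<noteq> 0})) = 2 * p * real CARD('n))"

definition isomorphic :: "(int ^ 'n \<Rightarrow> nat) \<Rightarrow> (int ^ 'n \<Rightarrow> nat) \<Rightarrow> bool" where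
  "isomorphic f g \<longleftrightarrow> (\<exists>\<phi>. grid_automorphism \<phi> \<and> f = g \<circ> \<phi>)"

definition biased_iso :: "real \<Rightarrow> ((int ^ 'n \<Rightarrow> nat) \<times> (int ^ 'n \<Rightarrow> nat)) set" where
  "biased_iso p = {(f, g). biased p f \<and> biased p g \<and> isomorphic f g}"

lemma grid_automorphism_inv:
  assumes "grid_automorphism \<phi>"
  shows "grid_automorphism (inv \<phi>)"
  using assms unfolding grid_automorphism_def
  by (metis bij_imp_bij_inv bij_inv_eq_iff)

lemma grid_automorphism_comp:
  "grid_automorphism \<phi> \<Longrightarrow> grid_automorphism \<psi> \<Longrightarrow> grid_automorphism (\<psi> \<circ> \<phi>)"
  unfolding grid_automorphism_def by (auto intro: bij_comp)

lemma equiv_biased_iso: "equiv {f. biased p f} (biased_iso p)"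
proof (rule equivI)
  have "isomorphic f f" for f :: "int ^ 'n \<Rightarrow> nat"
    unfolding isomorphic_def grid_automorphism_def by (intro exI[of _ id]) auto
  then show "refl_on {f. biased p f} (biased_iso p)"
    by (auto simp: refl_on_def biased_iso_def)
  show "biased_iso p \<subseteq> {f. biased p f} \<times> {f. biased p f}"
    by (auto simp: biased_iso_def)
  have "isomorphic g f" if fg: "isomorphic f g" for f g :: "int ^ 'n \<Rightarrow> nat"
  proof -
    obtain \<phi> where \<phi>: "grid_automorphism \<phi>" "f = g \<circ> \<phi>"
      using fg by (auto simp: isomorphic_def)
    then have "g = f \<circ> inv \<phi>"
      by (auto simp: grid_automorphism_def fun_eq_iff bij_is_surj surj_f_inv_f)
    then show ?thesis using grid_automorphism_inv[OF \<phi>(1)] by (auto simp: isomorphic_def)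
  qed
  then show "sym (biased_iso p)"
    by (auto simp: sym_def biased_iso_def)
  have "isomorphic f h" if "isomorphic f g" "isomorphic g h" for f g h :: "int ^ 'n \<Rightarrow> nat"
    using that grid_automorphism_comp unfolding isomorphic_def by (metis comp_assoc)
  then show "trans (biased_iso p)"
    unfolding trans_def biased_iso_def by blast
qed

end

theory Submission
  imports Defs "HOL-Library.Countable_Set"
begin

text \<open>
  Automorphisms of the grid are affine, because squares and opposite neighbours can be recognised
  from the number of common neighbours; hence there are only countably many of them, every
  isomorphism class is countable, and it suffices to find continuum many biased functions.

  Give the coordinates the weights \<open>1, 3, \<dots>, 2n - 1\<close> and let \<open>L\<close> be the resulting linear form.
  The \<open>2n\<close> neighbours of a point realise all residues of \<open>L\<close> modulo \<open>4n\<close> of one parity, so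
  \<open>L mod 4n < 2c\<close> defines a biased function. If \<open>D\<close> is the difference of the coordinates
  with weights \<open>1\<close> and \<open>2n - 1\<close>, then on the neighbours with a fixed value of \<open>D\<close> the residues of
  \<open>L\<close> form a set invariant under adding \<open>2n\<close>. So \<open>L\<close> may be replaced by \<open>L + 2n s(D)\<close> for
  an arbitrary \<open>s\<close>.
\<close>

section \<open>Automorphisms of the grid\<close>

lemma grid_nbhd_iff_diff: "y \<in> grid_nbhd x \<longleftrightarrow> y - x \<in> grid_nbhd 0"
  by (auto simp: grid_nbhd_def algebra_simps)

lemma grid_nbhd_0_iff: "u \<in> grid_nbhd 0 \<longleftrightarrow> (\<exists>i. u = axis i 1 \<or> u = - axis i 1)"
  by (auto simp: grid_nbhd_def)

lemma uminus_grid_nbhd_0: "u \<in> grid_nbhd 0 \<Longrightarrow> - u \<in> grid_nbhd 0"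
  by (force simp: grid_nbhd_0_iff)

lemma unit_nth_cases:
  assumes "u \<in> grid_nbhd (0 :: int ^ 'n)"
  shows "u $ i = 0 \<or> u = axis i 1 \<or> u = - axis i 1"
proof -
  obtain j where "u = axis j 1 \<or> u = - axis j 1"
    using assms by (auto simp: grid_nbhd_0_iff)
  then show ?thesis
    by (cases "j = i") (auto simp: axis_def)
qed

text \<open>Compare the coordinate \<open>i\<close> in which \<open>u\<close> is nonzero. Unless
  \<open>a = - u\<close>, no cancellation occurs on the left, so \<open>v\<close> or
  \<open>b\<close> must have the same entry as \<open>u\<close> there, and a unit vector is
  determined by a nonzero entry.\<close>

lemma unit_sum_cases:
  fixes u v a b :: "int ^ 'n"
  assumes "u \<in> grid_nbhd 0" "v \<in> grid_nbhd 0" "a \<in> grid_nbhd 0" "b \<in> grid_nbhd 0"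
    and eq: "u + a = v + b"
  shows "u = v \<or> u = - a \<or> u = b"
proof -
  obtain i where i: "u = axis i 1 \<or> u = - axis i 1"
    using assms(1) by (auto simp: grid_nbhd_0_iff)
  have "u $ i + a $ i = v $ i + b $ i"
    using eq by (metis vector_add_component)
  then show ?thesis
    using i unit_nth_cases[OF assms(2), of i] unit_nth_cases[OF assms(3), of i]
      unit_nth_cases[OF assms(4), of i]
    by auto
qed

lemma common_neighbour_cases:
  fixes x u v w :: "int ^ 'n"
  assumes "u \<in> grid_nbhd 0" "v \<in> grid_nbhd 0" "u \<noteq> v"
    and "w \<in> grid_nbhd (x + u)" "w \<in> grid_nbhd (x + v)"
  shows "w = x \<or> w = x + u + v"
proof -
  have "w - (x + u) \<in> grid_nbhd 0" "w - (x + v) \<in> grid_nbhd 0"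
    using assms grid_nbhd_iff_diff by blast+
  from unit_sum_cases[OF assms(1,2) this] assms(3) show ?thesis
    by (auto simp: algebra_simps)
qed

text \<open>For opposite neighbours the two candidates \<open>x\<close> and \<open>x + u + v\<close>
  coincide. This is how an automorphism recognises opposite pairs.\<close>

lemma common_neighbour_opposite:
  fixes x u w :: "int ^ 'n"
  assumes "u \<in> grid_nbhd 0" "w \<in> grid_nbhd (x + u)" "w \<in> grid_nbhd (x - u)"
  shows "w = x"
proof -
  have "u \<noteq> - u"
    using assms(1) by (auto simp: grid_nbhd_0_iff vec_eq_iff axis_def)
  then show ?thesis
    using common_neighbour_cases[of u "- u" w x] assms uminus_grid_nbhd_0 by auto
qed

section \<open>Rigidity of grid automorphisms\<close>

lemma grid_automorphism_nbhd:
  "grid_automorphism \<phi> \<Longrightarrow> \<phi> y \<in> grid_nbhd (\<phi> x) \<longleftrightarrow> y \<in> grid_nbhd x"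
  by (auto simp: grid_automorphism_def grid_nbhd_iff_edge)

lemma grid_automorphism_eq_iff: "grid_automorphism \<phi> \<Longrightarrow> \<phi> x = \<phi> y \<longleftrightarrow> x = y"
  by (auto simp: grid_automorphism_def bij_def inj_eq)

lemma grid_automorphism_step:
  assumes "grid_automorphism \<phi>" "u \<in> grid_nbhd 0"
  shows "\<phi> (x + u) - \<phi> x \<in> grid_nbhd 0"
proof -
  have "x + u \<in> grid_nbhd x"
    using assms(2) by (subst grid_nbhd_iff_diff) simp
  then show ?thesis
    using grid_automorphism_nbhd[OF assms(1)] grid_nbhd_iff_diff by blast
qed

lemma grid_automorphism_opposite:
  assumes \<phi>: "grid_automorphism \<phi>" and u: "u \<in> grid_nbhd 0"
  shows "\<phi> (x - u) = \<phi> x - (\<phi> (x + u) - \<phi> x)"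
proof (rule ccontr)
  assume neq: "\<phi> (x - u) \<noteq> \<phi> x - (\<phi> (x + u) - \<phi> x)"
  \<comment> \<open>The fourth vertex of the parallelogram on the images; its preimage is a common
    neighbour of \<open>x + u\<close> and \<open>x - u\<close>, hence \<open>x\<close> itself, so
    the parallelogram is degenerate.\<close>
  define w where "w = \<phi> (x + u) + \<phi> (x - u) - \<phi> x"
  have u': "- u \<in> grid_nbhd 0"
    using u by (rule uminus_grid_nbhd_0)
  obtain y where y: "w = \<phi> y"
    using \<phi> by (metis grid_automorphism_def bij_pointE)
  have "w - \<phi> (x + u) \<in> grid_nbhd 0" "w - \<phi> (x - u) \<in> grid_nbhd 0"
    using grid_automorphism_step[OF \<phi> u, of x] grid_automorphism_step[OF \<phi> u', of x]
    by (simp_all add: w_def)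
  then have "w \<in> grid_nbhd (\<phi> (x + u))" "w \<in> grid_nbhd (\<phi> (x - u))"
    using grid_nbhd_iff_diff by blast+
  then have "y \<in> grid_nbhd (x + u)" "y \<in> grid_nbhd (x - u)"
    using y grid_automorphism_nbhd[OF \<phi>] by auto
  then have "y = x"
    using common_neighbour_opposite[OF u] by blast
  then show False
    using neq y by (simp add: w_def algebra_simps)
qed

text \<open>Two distinct neighbours of \<open>\<phi> x\<close> have at most one common neighbour
  besides \<open>\<phi> x\<close>, namely the fourth vertex of their parallelogram, and
  \<open>x + u + v\<close> must be sent there.\<close>

lemma grid_automorphism_square:
  assumes \<phi>: "grid_automorphism \<phi>" and u: "u \<in> grid_nbhd 0" and v: "v \<in> grid_nbhd 0"
    and "u \<noteq> v" "u \<noteq> - v"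
  shows "\<phi> (x + u + v) = \<phi> (x + u) + \<phi> (x + v) - \<phi> x"
proof -
  define w where "w = x + u + v"
  have "w \<in> grid_nbhd (x + u)" "w \<in> grid_nbhd (x + v)"
    using u v by (subst grid_nbhd_iff_diff, simp add: w_def)+
  then have "\<phi> w \<in> grid_nbhd (\<phi> x + (\<phi> (x + u) - \<phi> x))"
    "\<phi> w \<in> grid_nbhd (\<phi> x + (\<phi> (x + v) - \<phi> x))"
    using grid_automorphism_nbhd[OF \<phi>] by auto
  moreover have "\<phi> (x + u) - \<phi> x \<noteq> \<phi> (x + v) - \<phi> x"
    using \<open>u \<noteq> v\<close> grid_automorphism_eq_iff[OF \<phi>] by auto
  ultimately have "\<phi> w = \<phi> x \<or> \<phi> w = \<phi> x + (\<phi> (x + u) - \<phi> x) + (\<phi> (x + v) - \<phi> x)"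
    using common_neighbour_cases grid_automorphism_step[OF \<phi>] u v by blast
  moreover have "w \<noteq> x"
    using \<open>u \<noteq> - v\<close> by (auto simp: w_def add.assoc eq_neg_iff_add_eq_0)
  ultimately show ?thesis
    using grid_automorphism_eq_iff[OF \<phi>] by (auto simp: w_def)
qed

text \<open>Opposite neighbours settle \<open>v = u\<close> and \<open>v = - u\<close>, squares
  settle the remaining directions. Propagated over the grid, this makes \<open>\<phi>\<close>
  affine.\<close>

lemma grid_automorphism_step_shift:
  assumes \<phi>: "grid_automorphism \<phi>" and u: "u \<in> grid_nbhd 0" and v: "v \<in> grid_nbhd 0"
  shows "\<phi> (x + v + u) - \<phi> (x + v) = \<phi> (x + u) - \<phi> x"
proof -
  consider "v = u" | "v = - u" | "u \<noteq> v" "u \<noteq> - v"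
    by fastforce
  then show ?thesis
  proof cases
    case 1
    then show ?thesis
      using grid_automorphism_opposite[OF \<phi> u, of "x + u"] by (simp add: algebra_simps)
  next
    case 2
    then show ?thesis
      using grid_automorphism_opposite[OF \<phi> u, of x] by (simp add: algebra_simps)
  next
    case 3
    then show ?thesis
      using grid_automorphism_square[OF \<phi> u v, of x] by (simp add: algebra_simps)
  qed
qed

lemma int_vec_induct [case_names zero plus minus]:
  fixes x :: "int ^ 'n"
  assumes zero: "P 0"
    and plus: "\<And>x i. P x \<Longrightarrow> P (x + axis i 1)"
    and minus: "\<And>x i. P x \<Longrightarrow> P (x - axis i 1)"
  shows "P x"
proof (induction "\<Sum>i\<in>UNIV. nat \<bar>x $ i\<bar>" arbitrary: x rule: less_induct)
  case less
  show ?case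
  proof (cases "x = 0")
    case True
    then show ?thesis using zero by simp
  next
    case False
    then obtain i where i: "x $ i \<noteq> 0"
      by (auto simp: vec_eq_iff)
    \<comment> \<open>One step towards the origin, which lowers the sum of absolute values.\<close>
    define y where "y = x - axis i (sgn (x $ i))"
    have y_nth: "y $ j = (if j = i then x $ i - sgn (x $ i) else x $ j)" for j
      by (auto simp: y_def axis_def)
    have "(\<Sum>j\<in>UNIV. nat \<bar>y $ j\<bar>) < (\<Sum>j\<in>UNIV. nat \<bar>x $ j\<bar>)"
    proof (rule sum_strict_mono_ex1)
      show "\<forall>j\<in>UNIV. nat \<bar>y $ j\<bar> \<le> nat \<bar>x $ j\<bar>"
        using i by (auto simp: y_nth sgn_if)
      show "\<exists>j\<in>UNIV. nat \<bar>y $ j\<bar> < nat \<bar>x $ j\<bar>"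
        using i by (intro bexI[of _ i]) (auto simp: y_nth sgn_if)
    qed simp
    then have "P y"
      by (rule less)
    moreover have "x = y + axis i 1 \<or> x = y - axis i 1"
      using i by (auto simp: y_def sgn_if vec_eq_iff axis_def)
    ultimately show ?thesis
      using plus minus by metis
  qed
qed

lemma grid_automorphism_affine:
  assumes "grid_automorphism \<phi>" "u \<in> grid_nbhd 0"
  shows "\<phi> (x + u) = \<phi> x + (\<phi> u - \<phi> 0)"
proof -
  have "\<phi> (x + u) - \<phi> x = \<phi> u - \<phi> 0"
  proof (induction x rule: int_vec_induct)
    case zero
    show ?case by simp
  next
    case (plus x i)
    then show ?case
      using grid_automorphism_step_shift[OF assms, of "axis i 1" x]
      by (auto simp: grid_nbhd_0_iff)
  next
    case (minus x i)
    then show ?case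
      using grid_automorphism_step_shift[OF assms, of "- axis i 1" x]
      by (auto simp: grid_nbhd_0_iff)
  qed
  then show ?thesis
    by (simp add: algebra_simps)
qed

lemma grid_automorphism_eqI:
  assumes \<phi>: "grid_automorphism \<phi>" and \<psi>: "grid_automorphism \<psi>"
    and "\<phi> 0 = \<psi> 0" and "\<And>i. \<phi> (axis i 1) = \<psi> (axis i 1)"
  shows "\<phi> = \<psi>"
proof
  fix x
  have unit: "axis i 1 \<in> grid_nbhd (0 :: int ^ 'a)" for i
    by (auto simp: grid_nbhd_0_iff)
  show "\<phi> x = \<psi> x"
  proof (induction x rule: int_vec_induct)
    case zero
    show ?case by (rule assms)
  next
    case (plus x i)
    then show ?case
      using grid_automorphism_affine[OF \<phi> unit] grid_automorphism_affine[OF \<psi> unit] assms by simp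
  next
    case (minus x i)
    then show ?case
      using grid_automorphism_affine[OF \<phi> unit, of "x - axis i 1" i]
        grid_automorphism_affine[OF \<psi> unit, of "x - axis i 1" i] assms by simp
  qed
qed

text \<open>An affine map is determined by its values at the origin and the basis vectors, so
  finitely many grid points encode an automorphism.\<close>

lemma countable_grid_automorphisms: "countable {\<phi> :: int ^ 'n \<Rightarrow> int ^ 'n. grid_automorphism \<phi>}"
proof -
  define code :: "(int ^ 'n \<Rightarrow> int ^ 'n) \<Rightarrow> (int ^ 'n) \<times> ((int ^ 'n) ^ 'n)"
    where "code \<phi> = (\<phi> 0, \<chi> i. \<phi> (axis i 1))" for \<phi>
  have "inj_on code {\<phi>. grid_automorphism \<phi>}"
    by (rule inj_onI) (auto simp: code_def vec_eq_iff intro!: grid_automorphism_eqI)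
  then show ?thesis
    using countableI_type countable_image_inj_on by blast
qed

lemma countable_isomorphic: "countable {g :: int ^ 'n \<Rightarrow> nat. isomorphic f g}"
proof (rule countable_subset)
  show "{g. isomorphic f g} \<subseteq> (\<lambda>\<phi>. f \<circ> \<phi>) ` {\<phi>. grid_automorphism \<phi>}"
  proof
    fix g assume "g \<in> {g. isomorphic f g}"
    then obtain \<phi> where \<phi>: "grid_automorphism \<phi>" "f = g \<circ> \<phi>"
      by (auto simp: isomorphic_def)
    then have "g = f \<circ> inv \<phi>"
      by (auto simp: grid_automorphism_def fun_eq_iff bij_is_surj surj_f_inv_f)
    then show "g \<in> (\<lambda>\<phi>. f \<circ> \<phi>) ` {\<phi>. grid_automorphism \<phi>}"
      using grid_automorphism_inv[OF \<phi>(1)] by blast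
  qed
qed (intro countable_image countable_grid_automorphisms)

section \<open>A family of biased functions\<close>

definition linear_form :: "('n \<Rightarrow> int) \<Rightarrow> int ^ 'n \<Rightarrow> int" where
  "linear_form a x = (\<Sum>i\<in>UNIV. a i * x $ i)"

lemma linear_form_add_axis: "linear_form a (x + axis i t) = linear_form a x + a i * t"
proof -
  have "(\<Sum>j\<in>UNIV. a j * axis i t $ j) = (\<Sum>j\<in>UNIV. if j = i then a i * t else 0)"
    by (rule sum.cong) (auto simp: axis_def)
  then show ?thesis
    by (simp add: linear_form_def distrib_left sum.distrib)
qed

lemma grid_nbhd_add_axis: "\<sigma> \<in> {1, - 1} \<Longrightarrow> x + axis i \<sigma> \<in> grid_nbhd x"
proof -
  have "axis i (- 1) = - axis i (1 :: int)"
    by (simp add: vec_eq_iff axis_def)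
  then show "\<sigma> \<in> {1, - 1} \<Longrightarrow> x + axis i \<sigma> \<in> grid_nbhd x"
    by (auto simp: grid_nbhd_def)
qed

lemma grid_nbhd_eq_images:
  "grid_nbhd x = range (\<lambda>i. x + axis i 1) \<union> range (\<lambda>i. x - axis i 1)"
  by (auto simp: grid_nbhd_def)

lemma card_grid_nbhd_le: "card (grid_nbhd (x :: int ^ 'n)) \<le> 2 * CARD('n)"
proof -
  have "card (grid_nbhd x) \<le> card (range (\<lambda>i. x + axis i 1)) + card (range (\<lambda>i. x - axis i 1))"
    unfolding grid_nbhd_eq_images by (rule card_Un_le)
  also have "\<dots> \<le> CARD('n) + CARD('n)"
    by (intro add_mono card_image_le) auto
  finally show ?thesis by simp
qed

lemma finite_grid_nbhd: "finite (grid_nbhd x)"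
  by (simp add: grid_nbhd_eq_images)

text \<open>Applied with \<open>m = 2n\<close> to count all residues attained on a neighbourhood,
  and with \<open>m = c\<close> to count those in the support.\<close>

lemma card_parity_class: "card {r \<in> {0..<2 * int m}. odd (r - l)} = m"
proof -
  define \<epsilon> :: int where "\<epsilon> = (if even l then 1 else 0)"
  have "r \<in> (\<lambda>j. 2 * j + \<epsilon>) ` {0..<int m}" if "r \<in> {0..<2 * int m}" "odd (r - l)" for r
    using that by (intro image_eqI[of _ _ "r div 2"]) (auto simp: \<epsilon>_def)
  moreover have "(\<lambda>j. 2 * j + \<epsilon>) ` {0..<int m} \<subseteq> {r \<in> {0..<2 * int m}. odd (r - l)}"
    by (auto simp: \<epsilon>_def)
  ultimately have "{r \<in> {0..<2 * int m}. odd (r - l)} = (\<lambda>j. 2 * j + \<epsilon>) ` {0..<int m}"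
    by blast
  moreover have "inj_on (\<lambda>j. 2 * j + \<epsilon>) {0..<int m}"
    by (auto simp: inj_on_def)
  ultimately show ?thesis
    by (simp add: card_image)
qed

text \<open>A step in a direction other than \<open>i0\<close>, \<open>i1\<close> leaves the
  argument of \<open>s\<close> fixed, so the shift is constant. The steps \<open>\<tau>\<close>
  along \<open>i0\<close> and \<open>- \<tau>\<close> along \<open>i1\<close> change that argument
  equally, while their values of \<open>linear_form a\<close> differ by
  \<open>2 * N * \<tau>\<close>; one of the two therefore attains the desired residue, whatever
  \<open>s\<close> is.\<close>

lemma neighbour_with_residue:
  fixes x :: "int ^ 'n" and a :: "'n \<Rightarrow> int" and s :: "int \<Rightarrow> int"
  defines "N \<equiv> int CARD('n)"
  assumes cover: "\<And>q. odd q \<Longrightarrow> \<exists>i. \<exists>\<sigma>\<in>{1, - 1}. \<exists>k. q = \<sigma> * a i + 4 * N * k"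
    and "i0 \<noteq> i1" and sum: "a i0 + a i1 = 2 * N"
    and r: "odd (r - linear_form a x)"
  shows "\<exists>y\<in>grid_nbhd x. 4 * N dvd r - (linear_form a y + 2 * N * s (y $ i0 - y $ i1))"
proof -
  define L where "L = linear_form a x"
  define d where "d = x $ i0 - x $ i1"
  have "odd (r - L - 2 * N * s d)"
    using r by (simp add: L_def)
  then obtain i \<sigma> k where \<sigma>: "\<sigma> \<in> {1, - 1}" and k: "r - L - 2 * N * s d = \<sigma> * a i + 4 * N * k"
    using cover by blast
  \<comment> \<open>Modulo \<open>2 * N\<close> the weights of \<open>i0\<close> and
    \<open>i1\<close> are negatives of each other, so both directions reduce to one form; the old
    shift \<open>s d\<close> is absorbed into \<open>m\<close>.\<close>
  have "(\<exists>\<tau>\<in>{1, - 1}. \<exists>m. r - L = \<tau> * a i0 + 2 * N * m) \<or> i \<noteq> i0 \<and> i \<noteq> i1"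
  proof -
    have "r - L = \<sigma> * a i0 + 2 * N * (2 * k + s d)" if "i = i0"
      using k that by (simp add: algebra_simps)
    moreover have "r - L = - \<sigma> * a i0 + 2 * N * (\<sigma> + 2 * k + s d)" if "i = i1"
    proof -
      have "a i = 2 * N - a i0"
        using sum that by simp
      with k have "r - L - 2 * N * s d = \<sigma> * (2 * N - a i0) + 4 * N * k"
        by (simp only:)
      then show ?thesis
        by (simp add: algebra_simps)
    qed
    moreover have "- \<sigma> \<in> {1, - 1}"
      using \<sigma> by auto
    ultimately show ?thesis
      using \<sigma> by blast
  qed
  then show ?thesis
  proof
    assume i: "i \<noteq> i0 \<and> i \<noteq> i1"
    let ?y = "x + axis i \<sigma>"
    have "?y $ i0 - ?y $ i1 = d"
      using i by (auto simp: d_def axis_def)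
    then have "r - (linear_form a ?y + 2 * N * s (?y $ i0 - ?y $ i1)) = 4 * N * k"
      using k by (simp add: linear_form_add_axis L_def[symmetric] algebra_simps)
    then show ?thesis
      using grid_nbhd_add_axis[OF \<sigma>] by (metis dvd_triv_left)
  next
    assume "\<exists>\<tau>\<in>{1, - 1}. \<exists>m. r - L = \<tau> * a i0 + 2 * N * m"
    then obtain \<tau> m where \<tau>: "\<tau> \<in> {1, - 1}" and m: "r - L = \<tau> * a i0 + 2 * N * m"
      by blast
    have dvd: "4 * N dvd 2 * N * t" if "even t" for t
    proof -
      from that obtain u where "t = 2 * u" ..
      then have "2 * N * t = 4 * N * u"
        by simp
      then show ?thesis
        by (metis dvd_triv_left)
    qed
    show ?thesis
    \<comment> \<open>The parity decides between the two steps that lead to the argument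
      \<open>d + \<tau>\<close>.\<close>
    proof (cases "even (m - s (d + \<tau>))")
      case True
      let ?y = "x + axis i0 \<tau>"
      have "?y $ i0 - ?y $ i1 = d + \<tau>"
        using \<open>i0 \<noteq> i1\<close> by (simp add: d_def axis_def)
      then have "r - (linear_form a ?y + 2 * N * s (?y $ i0 - ?y $ i1)) = 2 * N * (m - s (d + \<tau>))"
        using m by (simp add: linear_form_add_axis L_def[symmetric] algebra_simps)
      moreover have "4 * N dvd 2 * N * (m - s (d + \<tau>))"
        using True by (rule dvd)
      ultimately show ?thesis
        using grid_nbhd_add_axis[OF \<tau>] by metis
    next
      case False
      let ?y = "x + axis i1 (- \<tau>)"
      have D: "?y $ i0 - ?y $ i1 = d + \<tau>"
        using \<open>i0 \<noteq> i1\<close> by (simp add: d_def axis_def)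
      have a1: "a i1 = 2 * N - a i0"
        using sum by simp
      have "r - (linear_form a ?y + 2 * N * s (?y $ i0 - ?y $ i1))
          = 2 * N * (m - s (d + \<tau>) + \<tau>)"
        unfolding D using m
        by (simp add: linear_form_add_axis L_def[symmetric] a1 algebra_simps)
      moreover have "even (m - s (d + \<tau>) + \<tau>)"
        using False \<tau> by auto
      then have "4 * N dvd 2 * N * (m - s (d + \<tau>) + \<tau>)"
        by (rule dvd)
      moreover have "- \<tau> \<in> {1, - 1}"
        using \<tau> by auto
      ultimately show ?thesis
        using grid_nbhd_add_axis by metis
    qed
  qed
qed

section \<open>Biased functions from shifted linear forms\<close>

definition shifted_fun :: "nat \<Rightarrow> ('n \<Rightarrow> int) \<Rightarrow> 'n \<Rightarrow> 'n \<Rightarrow> (int \<Rightarrow> int) \<Rightarrow> int ^ 'n \<Rightarrow> nat" where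
  "shifted_fun c a i0 i1 s x =
     (if (linear_form a x + 2 * int CARD('n) * s (x $ i0 - x $ i1)) mod (4 * int CARD('n)) < 2 * int c
      then 1 else 0)"

text \<open>Pigeonhole: at most \<open>2n\<close> neighbours attain all \<open>2n\<close> residues
  of one parity, so \<open>F\<close> maps the neighbourhood bijectively onto them, and exactly
  \<open>c\<close> of these residues lie below \<open>2c\<close>.\<close>

lemma biased_shifted_fun:
  fixes a :: "'n::finite \<Rightarrow> int" and s :: "int \<Rightarrow> int"
  defines "N \<equiv> int CARD('n)"
  assumes "\<And>q. odd q \<Longrightarrow> \<exists>i. \<exists>\<sigma>\<in>{1, - 1}. \<exists>k. q = \<sigma> * a i + 4 * N * k"
    and "i0 \<noteq> i1" and "a i0 + a i1 = 2 * N"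
    and c: "c \<le> 2 * CARD('n)"
  shows "biased (real c / (2 * real CARD('n))) (shifted_fun c a i0 i1 s)"
proof -
  define F where "F y = (linear_form a y + 2 * N * s (y $ i0 - y $ i1)) mod (4 * N)" for y
  have "card (grid_nbhd x \<inter> {y. shifted_fun c a i0 i1 s y \<noteq> 0}) = c" for x
  proof -
    define T where "T = {r \<in> {0..<4 * N}. odd (r - linear_form a x)}"
    have T_sub: "T \<subseteq> F ` grid_nbhd x"
    proof
      fix r assume r: "r \<in> T"
      then obtain y where y: "y \<in> grid_nbhd x"
        "4 * N dvd r - (linear_form a y + 2 * N * s (y $ i0 - y $ i1))"
        using neighbour_with_residue[OF assms(2-4)[unfolded N_def], of r x s]
        unfolding T_def N_def by blast
      then have "r mod (4 * N) = F y"
        unfolding F_def by (simp only: mod_eq_dvd_iff)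
      moreover have "r mod (4 * N) = r"
        using r by (simp add: T_def)
      ultimately show "r \<in> F ` grid_nbhd x"
        using y by auto
    qed
    have card_T: "card T = 2 * CARD('n)"
      using card_parity_class[of "2 * CARD('n)" "linear_form a x"] by (simp add: T_def N_def)
    have "card (F ` grid_nbhd x) \<le> card (grid_nbhd x)"
      by (intro card_image_le finite_grid_nbhd)
    moreover have "card T \<le> card (F ` grid_nbhd x)"
      by (intro card_mono T_sub finite_imageI finite_grid_nbhd)
    ultimately have cards: "card (F ` grid_nbhd x) = card (grid_nbhd x)" "card (F ` grid_nbhd x) = card T"
      using card_grid_nbhd_le[of x] card_T by linarith+
    then have inj: "inj_on F (grid_nbhd x)"
      by (intro eq_card_imp_inj_on finite_grid_nbhd)
    have img: "F ` grid_nbhd x = T"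
      using T_sub cards by (metis card_subset_eq finite_grid_nbhd finite_imageI)
    have supp: "shifted_fun c a i0 i1 s y \<noteq> 0 \<longleftrightarrow> F y < 2 * int c" for y
      by (simp add: shifted_fun_def F_def N_def)
    have "card (grid_nbhd x \<inter> {y. shifted_fun c a i0 i1 s y \<noteq> 0})
        = card (F ` (grid_nbhd x \<inter> {y. F y < 2 * int c}))"
      unfolding supp by (rule card_image[symmetric]) (rule inj_on_subset[OF inj], blast)
    also have "F ` (grid_nbhd x \<inter> {y. F y < 2 * int c}) = T \<inter> {..<2 * int c}"
      using img by auto
    \<comment> \<open>The bound on \<open>c\<close> keeps the window \<open>{0..<2 * int c}\<close>
      within one period \<open>4 * N\<close>.\<close>
    also have "\<dots> = {r \<in> {0..<2 * int c}. odd (r - linear_form a x)}"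
      using c by (auto simp: T_def N_def)
    finally show ?thesis
      by (simp only: card_parity_class)
  qed
  then show ?thesis
    by (auto simp: biased_def shifted_fun_def)
qed

text \<open>The weights run through the odd numbers below \<open>2n\<close>. An odd residue modulo
  \<open>4n\<close> is neither \<open>0\<close> nor \<open>2n\<close>, so it lies in the lower half
  and is a weight, or in the upper half and is the negative of one.\<close>

lemma odd_weights_cover:
  fixes e :: "'n::finite \<Rightarrow> nat"
  assumes e: "bij_betw e UNIV {0..<CARD('n)}" and "odd q"
  shows "\<exists>i. \<exists>\<sigma>\<in>{1, - 1}. \<exists>k. q = \<sigma> * (2 * int (e i) + 1) + 4 * int CARD('n) * k"
proof -
  define N where "N = int CARD('n)"
  have N: "N > 0"
    by (simp add: N_def)
  have idx: "\<exists>i. m = 2 * int (e i) + 1" if "odd m" "0 < m" "m < 2 * N" for m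
  proof -
    have "nat (m div 2) \<in> {0..<CARD('n)}"
      using that by (auto simp: N_def)
    then obtain i where "e i = nat (m div 2)"
      using e by (metis bij_betw_def imageE)
    then have "m = 2 * int (e i) + 1"
      using that by auto
    then show ?thesis ..
  qed
  define m where "m = q mod (4 * N)"
  have q: "q = m + 4 * N * (q div (4 * N))"
    by (simp add: m_def)
  have m: "0 \<le> m" "m < 4 * N"
    using N by (simp_all add: m_def)
  have "odd m"
    using \<open>odd q\<close> by (subst (asm) q) simp
  then have "m \<noteq> 0" "m \<noteq> 2 * N"
    by auto
  then consider "0 < m" "m < 2 * N" | "0 < 4 * N - m" "4 * N - m < 2 * N"
    using m by linarith
  then show ?thesis
  proof cases
    case 1
    then obtain i where "m = 2 * int (e i) + 1"
      using idx \<open>odd m\<close> by blast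
    then show ?thesis
      using q unfolding N_def by (intro exI[of _ i] bexI[of _ 1]) auto
  next
    case 2
    then obtain i where "4 * N - m = 2 * int (e i) + 1"
      using idx \<open>odd m\<close> by force
    then have "q = - 1 * (2 * int (e i) + 1) + 4 * N * (q div (4 * N) + 1)"
      using q by (simp add: algebra_simps)
    then show ?thesis
      unfolding N_def by blast
  qed
qed

text \<open>A set \<open>A\<close> of naturals is written into the shift and read off along the axis
  \<open>i0\<close>, where \<open>linear_form a\<close> and the argument of \<open>s\<close> both
  equal the coordinate.\<close>

lemma biased_continuum:
  assumes n: "CARD('n::finite) > 1" and c: "c \<in> {1..2 * CARD('n) - 1}"
  shows "(UNIV :: nat set set) \<lesssim> {f :: int ^ 'n \<Rightarrow> nat. biased (real c / (2 * real CARD('n))) f}"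
proof -
  define N where "N = int CARD('n)"
  have N: "N > 1"
    using n by (simp add: N_def)
  obtain e :: "'n \<Rightarrow> nat" where e: "bij_betw e UNIV {0..<CARD('n)}"
    using ex_bij_betw_finite_nat[OF finite] by blast
  \<comment> \<open>The smallest and the largest weight, \<open>1\<close> and
    \<open>2 * N - 1\<close>, add up to \<open>2 * N\<close>.\<close>
  obtain i0 i1 where i0: "e i0 = 0" and i1: "e i1 = CARD('n) - 1"
    using e n by (metis (no_types, lifting) atLeastLessThan_iff bij_betw_def diff_less imageE
        le0 less_numeral_extra(1) less_trans)
  have "i0 \<noteq> i1"
    using i0 i1 n by auto
  define a where "a i = 2 * int (e i) + 1" for i
  have a0: "a i0 = 1" and a1: "a i1 = 2 * N - 1"
    using n by (auto simp: a_def i0 i1 N_def)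
  \<comment> \<open>Chosen so that of the residues \<open>\<rho>\<close> and
    \<open>\<rho> + 2 * N\<close> only the first lies below \<open>2c\<close>: adding
    \<open>2 * N\<close> at \<open>\<rho>\<close> then changes the value. The second case relies on
    \<open>c < 2 * N\<close>.\<close>
  define \<rho> where "\<rho> = (if int c \<le> N then 0 else 2 * N - 1)"
  define h where "h t = (if t mod (4 * N) < 2 * int c then 1 else 0 :: nat)" for t
  define s where "s A d = (if \<exists>k\<in>A. d = \<rho> + 4 * N * int k then 1 else 0 :: int)" for A d
  define f where "f A = shifted_fun c a i0 i1 (s A)" for A
  have "h \<rho> \<noteq> h (\<rho> + 2 * N)"
    using c N by (auto simp: h_def \<rho>_def N_def)
  moreover have "f A (axis i0 (\<rho> + 4 * N * int k)) = h (\<rho> + (if k \<in> A then 2 * N else 0))" for A k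
  proof -
    have "linear_form a (axis i0 t) = t" for t
      using linear_form_add_axis[of a 0 i0 t] by (simp add: a0 linear_form_def)
    moreover have "s A (\<rho> + 4 * N * int k) = (if k \<in> A then 1 else 0)"
      using N by (auto simp: s_def)
    ultimately have "f A (axis i0 (\<rho> + 4 * N * int k))
        = h (\<rho> + (if k \<in> A then 2 * N else 0) + 4 * N * int k)"
      using \<open>i0 \<noteq> i1\<close>
      by (simp add: f_def shifted_fun_def h_def N_def[symmetric] axis_def algebra_simps)
    also have "\<dots> = h (\<rho> + (if k \<in> A then 2 * N else 0))"
      by (simp only: h_def mod_mult_self2)
    finally show ?thesis .
  qed
  ultimately have "k \<in> A \<longleftrightarrow> k \<in> B" if "f A = f B" for A B k
    using that by (metis add.right_neutral)
  then have "inj f"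
    by (auto intro!: injI)
  moreover have "biased (real c / (2 * real CARD('n))) (f A)" for A
    unfolding f_def
  proof (rule biased_shifted_fun)
    show "\<exists>i. \<exists>\<sigma>\<in>{1, - 1}. \<exists>k. q = \<sigma> * a i + 4 * int CARD('n) * k" if "odd q" for q
      unfolding a_def using odd_weights_cover[OF e that] .
    show "a i0 + a i1 = 2 * int CARD('n)"
      by (simp add: a0 a1 N_def)
  qed (use \<open>i0 \<noteq> i1\<close> c in auto)
  ultimately show ?thesis
    unfolding lepoll_def by blast
qed

section \<open>Counting isomorphism classes\<close>

text \<open>A biased function is determined by its support, a subset of a countable type.\<close>

lemma biased_lepoll: "{f :: int ^ 'n \<Rightarrow> nat. biased p f} \<lesssim> (UNIV :: nat set set)"
proof -
  have "inj_on (\<lambda>f. to_nat ` {x. f x \<noteq> 0}) {f :: int ^ 'n \<Rightarrow> nat. biased p f}"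
  proof (rule inj_onI)
    fix f g :: "int ^ 'n \<Rightarrow> nat"
    assume fg: "f \<in> {f. biased p f}" "g \<in> {f. biased p f}"
      "to_nat ` {x. f x \<noteq> 0} = to_nat ` {x. g x \<noteq> 0}"
    then have "{x. f x \<noteq> 0} = {x. g x \<noteq> 0}"
      by (simp add: inj_image_eq_iff)
    then have "f x = 0 \<longleftrightarrow> g x = 0" for x
      by blast
    moreover have "f x = 0 \<or> f x = 1" "g x = 0 \<or> g x = 1" for x
      using fg(1,2) unfolding biased_def by blast+
    ultimately show "f = g"
      by (metis ext)
  qed
  then show ?thesis
    unfolding lepoll_def by blast
qed

section \<open>Comparing a set with its quotient\<close>

lemma quotient_lepoll: "A // r \<lesssim> A"
  unfolding quotient_def UNION_singleton_eq_range by (rule image_lepoll)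

text \<open>An element is recovered from its class and its index in an enumeration of that
  class.\<close>

lemma lepoll_quotient_Times_nat:
  assumes "equiv A r" and "\<And>x. x \<in> A \<Longrightarrow> countable (r `` {x})"
  shows "A \<lesssim> (A // r) \<times> (UNIV :: nat set)"
proof -
  define code where "code x = (r `` {x}, to_nat_on (r `` {x}) x)" for x
  have "inj_on code A"
  proof (rule inj_onI)
    fix x y assume xy: "x \<in> A" "y \<in> A" "code x = code y"
    then have "x \<in> r `` {x}" "y \<in> r `` {x}" "to_nat_on (r `` {x}) x = to_nat_on (r `` {x}) y"
      using equiv_class_self[OF assms(1)] by (auto simp: code_def)
    then show "x = y"
      using assms(2)[OF xy(1)] by (metis from_nat_into_to_nat_on)
  qed
  moreover have "code ` A \<subseteq> (A // r) \<times> UNIV"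
    by (auto simp: code_def quotientI)
  ultimately show ?thesis
    unfolding lepoll_def by blast
qed

text \<open>An infinite set is equipollent to its square, so a countable factor is absorbed.\<close>

lemma infinite_Times_nat_lepoll:
  assumes "infinite A"
  shows "A \<times> (UNIV :: nat set) \<lesssim> A"
proof -
  have "A \<times> (UNIV :: nat set) \<lesssim> A \<times> A"
    using assms by (intro times_lepoll_mono) (auto simp: infinite_le_lepoll)
  also have "A \<times> A \<approx> A"
    using card_of_Times_same_infinite[OF assms] by (simp add: eqpoll_iff_card_of_ordIso)
  finally show ?thesis .
qed

theorem theorem4p1:
  fixes c :: nat and p :: real
  assumes "CARD('n::finite) > 1"
    and "c \<in> {1..2 * CARD('n) - 1}"
    and "p = real c / (2 * real CARD('n))"
  shows "{f :: int ^ 'n \<Rightarrow> nat. biased p f} // biased_iso p \<approx> (UNIV :: nat set set)"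
proof (rule lepoll_antisym)
  let ?B = "{f :: int ^ 'n \<Rightarrow> nat. biased p f}"
  show "?B // biased_iso p \<lesssim> (UNIV :: nat set set)"
    using quotient_lepoll biased_lepoll by (rule lepoll_trans)
  have "countable (biased_iso p `` {f})" for f :: "int ^ 'n \<Rightarrow> nat"
    by (rule countable_subset[OF _ countable_isomorphic[of f]]) (auto simp: biased_iso_def)
  then have "?B \<lesssim> (?B // biased_iso p) \<times> (UNIV :: nat set)"
    by (intro lepoll_quotient_Times_nat equiv_biased_iso)
  then have le: "(UNIV :: nat set set) \<lesssim> (?B // biased_iso p) \<times> (UNIV :: nat set)"
    using biased_continuum[OF assms(1,2)] assms(3) lepoll_trans by blast
  \<comment> \<open>Needed to absorb the factor \<open>nat\<close>: finitely many countable classes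
    would make the power set of the naturals countable, against Cantor.\<close>
  have "infinite (?B // biased_iso p)"
  proof
    assume "finite (?B // biased_iso p)"
    then have "countable ((?B // biased_iso p) \<times> (UNIV :: nat set))"
      by (simp add: countable_finite)
    then have "countable (UNIV :: nat set set)"
      using le countable_lepoll by blast
    then have "(UNIV :: nat set set) \<lesssim> (UNIV :: nat set)"
      by (simp add: countable_def lepoll_def)
    then show False
      using lesspoll_Pow_self[of "UNIV :: nat set"] by (auto simp: lesspoll_def lepoll_antisym)
  qed
  then show "(UNIV :: nat set set) \<lesssim> ?B // biased_iso p"
    using le infinite_Times_nat_lepoll lepoll_trans by blast
qed

end
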